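(* Let $(X,d)$ be a compact metric space with diameter $D_X$. If $\mu,\nu\in\mathcal{B}(X,d)$, then \[ d_H(\Sigma_\mu,\Sigma_\nu)\le C_X\cdot w_1(\mu,\nu), \] where $C_X=\max\{1,4D_X\}$.
   Context: $\mathcal{B}(X,d)$ is the set of Borel probability measures on $(X,d)$. $O(X)$ is the set of all 1-Lipschitz functions $f\colon X\to\mathbb{R}$, with the metric induced by $\|f\|_\infty=\sup_{x\in X}|f(x)|$; $O(X)\times O(X)$ carries the metric induced by $\|(f,g)\|_\infty=\max\{\|f\|_\infty,\|g\|_\infty\}$. For $\mu\in\mathcal{B}(X,d)$, $M_\mu f=\int_X f\,d\mu$ and $O^c_\mu=\{f\in O(X): M_\mu f=0\}$ is the set of $\mu$-centered observables. The observable covariance is $\Sigma_\mu\colon O^c_\mu\times O^c_\mu\to\mathbb{R}$, $\Sigma_\mu(f,g)=\int_X f(x)g(x)\,d\mu(x)$. Functional Hausdorff distance: let $(Z,d_Z)$ be a metric space and $\phi\colon A\to\mathbb{R}$, $\psi\colon B\to\mathbb{R}$ continuous functions on compact subspaces $A,B\subseteq Z$. A real number $\epsilon>0$ is admissible for $(\phi,\psi)$ if (a) for any $a\in A$ there is $b\in B$ with $d_Z(a,b)<\epsilon$ and $|\phi(a)-\psi(b)|<\epsilon$; and (b) for any $b\in B$ there is $a\in A$ with $d_Z(a,b)<\epsilon$ and $|\phi(a)-\psi(b)|<\epsilon$. Then $d_H(\phi,\psi)=\inf\{\epsilon>0:\epsilon\text{ is admissible for }(\phi,\psi)\}$. Here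 it is applied with $Z=O(X)\times O(X)$, $A=O^c_\mu\times O^c_\mu$, $B=O^c_\nu\times O^c_\nu$, $\phi=\Sigma_\mu$, $\psi=\Sigma_\nu$. The Wasserstein 1-distance is $w_1(\mu,\nu)=\inf_{h}\int_{X\times X}d(x,y)\,dh(x,y)$, the infimum over all Borel probability measures $h$ on $X\times X$ with first marginal $\mu$ and second marginal $\nu$. *)

theory Defs
  imports "HOL-Probability.Probability"
begin

definition borel_probs :: "'a::topological_space measure set" where
  "borel_probs = {\<mu>. prob_space \<mu> \<and> sets \<mu> = sets borel}"


subsection \<open>Observables\<close>

text \<open>
  The library metric on the type of bounded continuous functions is the one induced by the
  supremum norm.  On a compact space every 1-Lipschitz function is bounded and continuous, so
  \<open>observables\<close> contains all of them; see \<open>observables_compact\<close>.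
\<close>

definition observables :: "('a::metric_space \<Rightarrow>\<^sub>C real) set" where
  "observables = {f. 1-lipschitz_on UNIV (apply_bcontfun f)}"

lemma observables_compact:
  assumes "compact (UNIV :: 'a::metric_space set)"
  shows "apply_bcontfun ` observables = {f :: 'a \<Rightarrow> real. 1-lipschitz_on UNIV f}"
proof
  show "apply_bcontfun ` observables \<subseteq> {f :: 'a \<Rightarrow> real. 1-lipschitz_on UNIV f}"
    by (auto simp: observables_def)
  show "{f :: 'a \<Rightarrow> real. 1-lipschitz_on UNIV f} \<subseteq> apply_bcontfun ` observables"
  proof
    fix f :: "'a \<Rightarrow> real" assume "f \<in> {f. 1-lipschitz_on UNIV f}"
    then have f: "1-lipschitz_on UNIV f" by simp
    then have c: "continuous_on UNIV f"
      by (rule lipschitz_on_continuous_on)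
    then have "bounded (range f)"
      using assms compact_continuous_image compact_imp_bounded by blast
    with c have "f \<in> bcontfun" by (simp add: bcontfun_def)
    then have "f = apply_bcontfun (Bcontfun f)" by (simp add: Bcontfun_inverse)
    with f show "f \<in> apply_bcontfun ` observables"
      by (metis (mono_tags) image_eqI mem_Collect_eq observables_def)
  qed
qed

definition centered_observables :: "'a::metric_space measure \<Rightarrow> ('a \<Rightarrow>\<^sub>C real) set" where
  "centered_observables \<mu> = {f \<in> observables. (\<integral>x. f x \<partial>\<mu>) = 0}"

definition obs_cov ::
    "'a::metric_space measure \<Rightarrow> ('a \<Rightarrow>\<^sub>C real) \<times> ('a \<Rightarrow>\<^sub>C real) \<Rightarrow> real" where
  "obs_cov \<mu> = (\<lambda>(f, g). \<integral>x. f x * g x \<partial>\<mu>)"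


subsection \<open>Functional Hausdorff distance\<close>

text \<open>
  The metric of the ambient space is an explicit argument because the product carries the
  maximum metric here, whereas the type class instance for products is the Euclidean one.
\<close>

definition max_dist :: "'a::metric_space \<times> 'b::metric_space \<Rightarrow> 'a \<times> 'b \<Rightarrow> real" where
  "max_dist p q = max (dist (fst p) (fst q)) (dist (snd p) (snd q))"

lemma Metric_space_max_dist: "Metric_space S max_dist"
proof
  fix p q r :: "'a \<times> 'b"
  show "0 \<le> max_dist p q" by (simp add: max_dist_def le_max_iff_disj)
  show "max_dist p q = max_dist q p" by (simp add: max_dist_def dist_commute)
  show "max_dist p q = 0 \<longleftrightarrow> p = q"
    by (metis dist_self dist_le_zero_iff max.cobounded1 max.cobounded2 max.idem max_dist_def prod_eq_iff)
  show "max_dist p r \<le> max_dist p q + max_dist q r"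
    using dist_triangle[of "fst p" "fst r" "fst q"] dist_triangle[of "snd p" "snd r" "snd q"]
    unfolding max_dist_def by linarith
qed

definition hausdorff_admissible ::
    "('z \<Rightarrow> 'z \<Rightarrow> real) \<Rightarrow> 'z set \<Rightarrow> 'z set \<Rightarrow> ('z \<Rightarrow> real) \<Rightarrow> ('z \<Rightarrow> real) \<Rightarrow> real \<Rightarrow> bool" where
  "hausdorff_admissible d A B \<phi> \<psi> \<epsilon> \<longleftrightarrow>
     (\<forall>a\<in>A. \<exists>b\<in>B. d a b < \<epsilon> \<and> \<bar>\<phi> a - \<psi> b\<bar> < \<epsilon>) \<and>
     (\<forall>b\<in>B. \<exists>a\<in>A. d a b < \<epsilon> \<and> \<bar>\<phi> a - \<psi> b\<bar> < \<epsilon>)"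

definition functional_hausdorff_dist ::
    "('z \<Rightarrow> 'z \<Rightarrow> real) \<Rightarrow> 'z set \<Rightarrow> 'z set \<Rightarrow> ('z \<Rightarrow> real) \<Rightarrow> ('z \<Rightarrow> real) \<Rightarrow> real" where
  "functional_hausdorff_dist d A B \<phi> \<psi> = Inf {\<epsilon>. \<epsilon> > 0 \<and> hausdorff_admissible d A B \<phi> \<psi> \<epsilon>}"


subsection \<open>Wasserstein distance\<close>

definition couplings ::
    "'a::topological_space measure \<Rightarrow> 'a measure \<Rightarrow> ('a \<times> 'a) measure set" where
  "couplings \<mu> \<nu> = {h \<in> borel_probs. distr h borel fst = \<mu> \<and> distr h borel snd = \<nu>}"

definition wasserstein1 :: "'a::metric_space measure \<Rightarrow> 'a measure \<Rightarrow> real" where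
  "wasserstein1 \<mu> \<nu> = (INF h \<in> couplings \<mu> \<nu>. \<integral>p. dist (fst p) (snd p) \<partial>h)"

end

theory Submission
  imports Defs
begin

text \<open>
  The map \<open>f \<mapsto> f - \<integral>f d\<nu>\<close> turns \<open>\<mu>\<close>-centered observables into \<open>\<nu>\<close>-centered ones, and it is used
  in both coordinates to match a pair of \<open>\<mu>\<close>-centered observables \<open>(f, g)\<close> with a \<open>\<nu>\<close>-centered pair.
  Everything is then controlled by the easy half of Kantorovich duality
  (\<open>coupling_lipschitz_bound\<close>): a coupling of transport cost \<open>K\<close> bounds \<open>\<bar>\<integral>u d\<mu> - \<integral>u d\<nu>\<bar>\<close> by
  \<open>L K\<close> for every \<open>L\<close>-Lipschitz \<open>u\<close>.

  Because \<open>f\<close> is \<open>\<mu>\<close>-centered, \<open>\<bar>\<integral>f d\<nu>\<bar>\<close> is the difference of the two integrals, so the observables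
  move by at most \<open>K\<close>.  For the covariances, \<open>\<Sigma>\<^sub>\<mu>(f, g)\<close> differs from the covariance of the
  recentered pair by \<open>(\<integral>fg d\<mu> - \<integral>fg d\<nu>) + (\<integral>f d\<nu>) (\<integral>g d\<nu>)\<close>.
  A centered observable takes values in \<open>[-D, D]\<close>, where \<open>D\<close> is the diameter; hence \<open>fg\<close> is
  \<open>2D\<close>-Lipschitz and the first difference is at most \<open>2DK\<close>, while the last product is at most
  \<open>DK\<close>.  The shift \<open>K\<close> and the total \<open>3DK\<close> are both at most \<open>max 1 (4D) K\<close>
  (\<open>recenter_pair\<close>), and exchanging the measures gives the reverse matching; so every larger
  number is admissible.  It remains to take the infimum over couplings,
  which is meaningful because the product measure is a coupling (\<open>couplings_nonempty\<close>).
\<close>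

section \<open>Existence of couplings\<close>

text \<open>
  A compact metric space is second countable, so each open subset of the square is a countable
  union of open rectangles.  The rectangles used here are products of balls of radius \<open>1/(n+1)\<close>
  centered at the points of a finite net of that mesh; around a point of an open set, such a
  rectangle stays inside the set as soon as the mesh is at most half the radius of a box contained in it.
\<close>

lemma sets_borel_prod_compact:
  assumes "compact (UNIV :: 'a::metric_space set)"
  shows "sets (borel \<Otimes>\<^sub>M borel) = sets (borel :: ('a \<times> 'a) measure)"
proof
  have "\<exists>k. finite k \<and> (UNIV :: 'a set) \<subseteq> (\<Union>x\<in>k. ball x (1 / real (Suc n)))" for n
    using assms unfolding compact_eq_totally_bounded
    by (meson of_nat_0_less_iff zero_less_Suc zero_less_divide_1_iff)
  then obtain N where finN: "\<And>n. finite (N n)"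
    and covN: "\<And>n. (UNIV :: 'a set) \<subseteq> (\<Union>x\<in>N n. ball x (1 / real (Suc n)))"
    by metis
  have open_in: "U \<in> sets (borel \<Otimes>\<^sub>M borel)" if U: "open U" for U :: "('a \<times> 'a) set"
  proof -
    define R where "R n a b = ball a (1 / real (Suc n)) \<times> ball b (1 / real (Suc n))"
      for n and a b :: 'a
    define V where
      "V = (\<Union>n. \<Union>(a, b) \<in> {(a, b) \<in> N n \<times> N n. R n a b \<subseteq> U}. R n a b)"
    have "U \<subseteq> V"
    proof
      fix p assume "p \<in> U"
      obtain x y where p: "p = (x, y)" by (cases p)
      with \<open>p \<in> U\<close> U obtain A B where AB: "open A" "open B" "x \<in> A" "y \<in> B" "A \<times> B \<subseteq> U"
        by (auto simp: open_prod_def)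
      obtain e1 where e1: "e1 > 0" "ball x e1 \<subseteq> A" using AB open_contains_ball by blast
      obtain e2 where e2: "e2 > 0" "ball y e2 \<subseteq> B" using AB open_contains_ball by blast
      obtain n where n: "1 / real (Suc n) < min e1 e2 / 2"
        using nat_approx_posE[of "min e1 e2 / 2"] e1 e2 by auto
      obtain a b where a: "a \<in> N n" "x \<in> ball a (1 / real (Suc n))"
        and b: "b \<in> N n" "y \<in> ball b (1 / real (Suc n))"
        using covN[of n] by blast
      have "ball a (1 / real (Suc n)) \<subseteq> ball x e1"
      proof
        fix z assume "z \<in> ball a (1 / real (Suc n))"
        then show "z \<in> ball x e1"
          using a n dist_triangle[of x z a] by (simp add: dist_commute)
      qed
      moreover have "ball b (1 / real (Suc n)) \<subseteq> ball y e2"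
      proof
        fix z assume "z \<in> ball b (1 / real (Suc n))"
        then show "z \<in> ball y e2"
          using b n dist_triangle[of y z b] by (simp add: dist_commute)
      qed
      ultimately have "R n a b \<subseteq> U"
        using e1 e2 AB unfolding R_def by blast
      moreover have "p \<in> R n a b" using a b p by (simp add: R_def)
      ultimately show "p \<in> V" unfolding V_def using a b by blast
    qed
    moreover have "V \<subseteq> U" unfolding V_def by blast
    ultimately have "U = V" by blast
    moreover have "V \<in> sets (borel \<Otimes>\<^sub>M borel)"
      unfolding V_def
    proof (intro sets.countable_UN subsetI, elim imageE, hypsubst)
      fix n
      have "finite {(a, b) \<in> N n \<times> N n. R n a b \<subseteq> U}"
        using finN[of n] by (intro finite_subset[OF _ finite_cartesian_product]) auto
      then show "(\<Union>(a, b) \<in> {(a, b) \<in> N n \<times> N n. R n a b \<subseteq> U}. R n a b)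
          \<in> sets (borel \<Otimes>\<^sub>M borel)"
        by (rule sets.finite_UN) (auto simp: R_def)
    qed
    ultimately show ?thesis by simp
  qed
  show "sets (borel :: ('a \<times> 'a) measure) \<subseteq> sets (borel \<Otimes>\<^sub>M borel)"
  proof
    fix S :: "('a \<times> 'a) set" assume "S \<in> sets borel"
    then have "S \<in> sigma_sets UNIV {U. open U}" by (simp add: borel_def)
    then show "S \<in> sets (borel \<Otimes>\<^sub>M borel)"
    proof (induction rule: sigma_sets.induct)
      case (Compl T)
      then show ?case
        using sets.compl_sets[of T "borel \<Otimes>\<^sub>M borel"] by (simp add: space_pair_measure)
    qed (use open_in in auto)
  qed
  have "fst \<in> measurable (borel :: ('a \<times> 'a) measure) borel"
    and "snd \<in> measurable (borel :: ('a \<times> 'a) measure) borel"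
    by (intro borel_measurable_continuous_onI continuous_intros)+
  then have "(\<lambda>p. (fst p, snd p)) \<in> measurable (borel :: ('a \<times> 'a) measure) (borel \<Otimes>\<^sub>M borel)"
    by (rule measurable_Pair)
  then have id: "(\<lambda>p. p) \<in> measurable (borel :: ('a \<times> 'a) measure) (borel \<Otimes>\<^sub>M borel)"
    by simp
  show "sets (borel \<Otimes>\<^sub>M borel) \<subseteq> sets (borel :: ('a \<times> 'a) measure)"
    using measurable_sets[OF id] by (intro subsetI) simp
qed

text \<open>
  The product measure is the witness.  It lives on the product \<open>\<sigma>\<close>-algebra, whereas couplings
  are measures on the Borel sets of the square; compactness makes the two agree.
\<close>

lemma couplings_nonempty:
  fixes \<mu> \<nu> :: "'a::metric_space measure"
  assumes comp: "compact (UNIV :: 'a set)" and "\<mu> \<in> borel_probs" "\<nu> \<in> borel_probs"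
  shows "couplings \<mu> \<nu> \<noteq> {}"
proof -
  interpret M: prob_space \<mu> using assms by (simp add: borel_probs_def)
  interpret N: prob_space \<nu> using assms by (simp add: borel_probs_def)
  interpret P: pair_prob_space \<mu> \<nu> ..
  have sets: "sets \<mu> = sets borel" "sets \<nu> = sets borel"
    using assms by (auto simp: borel_probs_def)
  have "sets (\<mu> \<Otimes>\<^sub>M \<nu>) = sets borel"
    using sets_borel_prod_compact[OF comp] sets_pair_measure_cong[OF sets] by simp
  then have "\<mu> \<Otimes>\<^sub>M \<nu> \<in> borel_probs"
    using P.prob_space_axioms by (simp add: borel_probs_def)
  moreover have "distr (\<mu> \<Otimes>\<^sub>M \<nu>) borel fst = \<mu>"
    using N.distr_pair_fst[of \<mu>] sets by (metis distr_cong)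
  moreover have "distr (\<mu> \<Otimes>\<^sub>M \<nu>) borel snd = \<nu>"
  proof -
    have "distr (\<mu> \<Otimes>\<^sub>M \<nu>) borel snd = distr (distr (\<nu> \<Otimes>\<^sub>M \<mu>) (\<mu> \<Otimes>\<^sub>M \<nu>) (\<lambda>(x, y). (y, x))) \<nu> snd"
      by (subst P.distr_pair_swap) (simp add: sets cong: distr_cong)
    also have "\<dots> = distr (\<nu> \<Otimes>\<^sub>M \<mu>) \<nu> fst"
      by (subst distr_distr) (auto simp: comp_def split_beta)
    finally show ?thesis using M.distr_pair_fst[of \<nu>] by simp
  qed
  ultimately show ?thesis unfolding couplings_def by blast
qed

section \<open>Lipschitz functions and couplings\<close>

lemma integrable_continuous_compact:
  fixes f :: "'a::topological_space \<Rightarrow> real"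
  assumes "compact (UNIV :: 'a set)" "\<mu> \<in> borel_probs" "continuous_on UNIV f"
  shows "integrable \<mu> f"
proof -
  interpret prob_space \<mu> using assms by (simp add: borel_probs_def)
  have "bounded (range f)"
    using assms compact_continuous_image compact_imp_bounded by blast
  then obtain B where B: "\<And>x. norm (f x) \<le> B" by (auto simp: bounded_iff)
  have "f \<in> borel_measurable \<mu>"
    using borel_measurable_continuous_onI[OF assms(3)] assms(2)
    by (simp add: borel_probs_def cong: measurable_cong_sets)
  with B show ?thesis by (intro integrable_const_bound[of _ B]) auto
qed

lemma dist_le_diameter_compact:
  assumes "compact (UNIV :: 'a::metric_space set)"
  shows "dist x (y :: 'a) \<le> diameter (UNIV :: 'a set)"
  using diameter_bounded_bound[OF compact_imp_bounded[OF assms]] by simp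

lemma compact_UNIV_prod:
  assumes "compact (UNIV :: 'a::topological_space set)"
  shows "compact (UNIV :: ('a \<times> 'a) set)"
  using compact_Times[OF assms assms] by simp

text \<open>
  Both integrals are integrals against the coupling, of \<open>u\<close> composed with one of the projections,
  and the integrands differ pointwise by at most \<open>L\<close> times the distance.
\<close>

lemma coupling_lipschitz_bound:
  fixes \<mu> \<nu> :: "'a::metric_space measure"
  assumes comp: "compact (UNIV :: 'a set)" and h: "h \<in> couplings \<mu> \<nu>"
    and u: "L-lipschitz_on UNIV u"
  shows "\<bar>(\<integral>x. u x \<partial>\<mu>) - (\<integral>x. u x \<partial>\<nu>)\<bar> \<le> L * (\<integral>p. dist (fst p) (snd p) \<partial>h)"
proof -
  have hb: "h \<in> borel_probs" and \<mu>: "distr h borel fst = \<mu>" and \<nu>: "distr h borel snd = \<nu>"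
    using h by (auto simp: couplings_def)
  note int = integrable_continuous_compact[OF compact_UNIV_prod[OF comp] hb]
  have cu: "continuous_on UNIV u" using u by (rule lipschitz_on_continuous_on)
  have bu: "u \<in> borel_measurable borel" using cu by (rule borel_measurable_continuous_onI)
  have "fst \<in> measurable h borel" "snd \<in> measurable h borel"
    using hb borel_measurable_continuous_onI[OF continuous_on_fst[OF continuous_on_id]]
      borel_measurable_continuous_onI[OF continuous_on_snd[OF continuous_on_id]]
    by (simp_all add: borel_probs_def cong: measurable_cong_sets)
  then have "(\<integral>x. u x \<partial>\<mu>) = (\<integral>p. u (fst p) \<partial>h)" "(\<integral>x. u x \<partial>\<nu>) = (\<integral>p. u (snd p) \<partial>h)"
    unfolding \<mu>[symmetric] \<nu>[symmetric] using bu by (simp_all add: integral_distr)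
  moreover have i1: "integrable h (\<lambda>p. u (fst p))" and i2: "integrable h (\<lambda>p. u (snd p))"
    by (intro int continuous_on_compose2[OF cu] continuous_intros; simp)+
  moreover have "\<bar>\<integral>p. u (fst p) - u (snd p) \<partial>h\<bar> \<le> (\<integral>p. L * dist (fst p) (snd p) \<partial>h)"
  proof (rule order_trans[OF integral_abs_bound integral_mono])
    show "integrable h (\<lambda>p. \<bar>u (fst p) - u (snd p)\<bar>)" using i1 i2 by auto
    show "integrable h (\<lambda>p. L * dist (fst p) (snd p))" by (intro int continuous_intros)
    show "\<bar>u (fst p) - u (snd p)\<bar> \<le> L * dist (fst p) (snd p)" for p
      using lipschitz_onD[OF u, of "fst p" "snd p"] by (simp add: dist_real_def)
  qed
  ultimately show ?thesis by simp
qed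

section \<open>Centered observables\<close>

text \<open>
  For a probability measure \<open>\<mu>\<close> and centered \<open>f\<close>, the value \<open>f x\<close> is the average over \<open>y\<close> of
  \<open>f x - f y\<close>, which is at most the diameter.
\<close>

lemma centered_lipschitz_bound:
  fixes f :: "'a::metric_space \<Rightarrow> real"
  assumes comp: "compact (UNIV :: 'a set)" and \<mu>: "\<mu> \<in> borel_probs"
    and f: "1-lipschitz_on UNIV f" and zero: "(\<integral>x. f x \<partial>\<mu>) = 0"
  shows "\<bar>f x\<bar> \<le> diameter (UNIV :: 'a set)"
proof -
  interpret prob_space \<mu> using \<mu> by (simp add: borel_probs_def)
  have int: "integrable \<mu> f"
    using integrable_continuous_compact[OF comp \<mu>] lipschitz_on_continuous_on[OF f] by blast
  have "f x = (\<integral>y. f x - f y \<partial>\<mu>)" using int zero by (simp add: prob_space)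
  also have "\<bar>\<dots>\<bar> \<le> (\<integral>y. diameter (UNIV :: 'a set) \<partial>\<mu>)"
  proof (rule order_trans[OF integral_abs_bound integral_mono])
    show "integrable \<mu> (\<lambda>y. \<bar>f x - f y\<bar>)" using int by auto
    show "\<bar>f x - f y\<bar> \<le> diameter (UNIV :: 'a set)" for y
      using lipschitz_onD[OF f, of x y] dist_le_diameter_compact[OF comp, of x y]
      by (simp add: dist_real_def)
  qed simp
  finally show ?thesis by (simp add: prob_space)
qed

lemma lipschitz_on_mult_bounded:
  fixes f g :: "'a::metric_space \<Rightarrow> real"
  assumes f: "L-lipschitz_on S f" and g: "M-lipschitz_on S g"
    and A: "\<And>x. x \<in> S \<Longrightarrow> \<bar>f x\<bar> \<le> A" and B: "\<And>x. x \<in> S \<Longrightarrow> \<bar>g x\<bar> \<le> B"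
    and nonneg: "0 \<le> A" "0 \<le> B"
  shows "(A * M + B * L)-lipschitz_on S (\<lambda>x. f x * g x)"
proof (rule lipschitz_onI)
  fix x y assume xy: "x \<in> S" "y \<in> S"
  have "f x * g x - f y * g y = f x * (g x - g y) + g y * (f x - f y)"
    by (simp add: algebra_simps)
  then have "\<bar>f x * g x - f y * g y\<bar> \<le> \<bar>f x\<bar> * \<bar>g x - g y\<bar> + \<bar>g y\<bar> * \<bar>f x - f y\<bar>"
    by (metis abs_mult abs_triangle_ineq)
  also have "\<dots> \<le> A * (M * dist x y) + B * (L * dist x y)"
    using xy lipschitz_onD[OF f, of x y] lipschitz_onD[OF g, of x y] A[of x] B[of y] nonneg
    by (intro add_mono mult_mono) (auto simp: dist_real_def)
  finally show "dist (f x * g x) (f y * g y) \<le> (A * M + B * L) * dist x y"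
    by (simp add: dist_real_def algebra_simps)
next
  show "0 \<le> A * M + B * L"
    using nonneg lipschitz_on_nonneg[OF f] lipschitz_on_nonneg[OF g] by simp
qed

text \<open>
  Subtracting the \<open>\<nu>\<close>-mean is the matching behind the Hausdorff bound.  The hypothesis \<open>K\<close>
  is stated for the pair of measures and not for a coupling, so that it can be
  used with the two measures exchanged.
\<close>

lemma recenter_pair:
  fixes \<mu> \<nu> :: "'a::metric_space measure"
  assumes comp: "compact (UNIV :: 'a set)" and \<mu>: "\<mu> \<in> borel_probs" and \<nu>: "\<nu> \<in> borel_probs"
    and K: "\<And>L u. L-lipschitz_on UNIV u \<Longrightarrow> \<bar>(\<integral>x. u x \<partial>\<mu>) - (\<integral>x. u x \<partial>\<nu>)\<bar> \<le> L * K"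
    and a: "a \<in> centered_observables \<mu> \<times> centered_observables \<mu>"
  shows "\<exists>b \<in> centered_observables \<nu> \<times> centered_observables \<nu>.
    max_dist a b \<le> K \<and> \<bar>obs_cov \<mu> a - obs_cov \<nu> b\<bar> \<le> 3 * diameter (UNIV :: 'a set) * K"
proof -
  interpret N: prob_space \<nu> using \<nu> by (simp add: borel_probs_def)
  let ?D = "diameter (UNIV :: 'a set)"
  obtain f g where a_eq: "a = (f, g)" by (cases a)
  have f: "1-lipschitz_on UNIV f" and f0: "(\<integral>x. f x \<partial>\<mu>) = 0"
    and g: "1-lipschitz_on UNIV g" and g0: "(\<integral>x. g x \<partial>\<mu>) = 0"
    using a by (auto simp: a_eq centered_observables_def observables_def)
  note fD = centered_lipschitz_bound[OF comp \<mu> f f0]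
  note gD = centered_lipschitz_bound[OF comp \<mu> g g0]
  have D: "0 \<le> ?D" using fD[of undefined] by linarith
  have cf: "continuous_on UNIV f" and cg: "continuous_on UNIV g"
    using f g lipschitz_on_continuous_on by blast+
  note int = integrable_continuous_compact[OF comp \<nu>]
  have int_f: "integrable \<nu> f" and int_g: "integrable \<nu> g"
    and int_fg: "integrable \<nu> (\<lambda>x. f x * g x)"
    by (intro int cf cg continuous_intros)+
  define m where "m u = (\<integral>x. apply_bcontfun u x \<partial>\<nu>)" for u :: "'a \<Rightarrow>\<^sub>C real"
  define c where "c u = u - const_bcontfun (m u)" for u :: "'a \<Rightarrow>\<^sub>C real"
  have c_apply: "c u x = u x - m u" for u x
    by (simp add: c_def minus_bcontfun.rep_eq const_bcontfun.rep_eq)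
  have centered: "c u \<in> centered_observables \<nu>"
    if "1-lipschitz_on UNIV u" "integrable \<nu> u" for u :: "'a \<Rightarrow>\<^sub>C real"
  proof -
    have "(\<integral>x. c u x \<partial>\<nu>) = (\<integral>x. u x - m u \<partial>\<nu>)" by (simp only: c_apply)
    also have "\<dots> = 0" using that(2) by (simp add: N.prob_space m_def)
    finally have "(\<integral>x. c u x \<partial>\<nu>) = 0" .
    moreover have "1-lipschitz_on UNIV (c u)"
      using that(1) by (simp add: c_apply lipschitz_on_def dist_real_def)
    ultimately show ?thesis by (simp add: centered_observables_def observables_def)
  qed
  have dist_c: "dist u (c u) \<le> \<bar>m u\<bar>" for u
    by (rule dist_bound) (simp add: c_apply dist_real_def)
  have mf: "\<bar>m f\<bar> \<le> K" and mg: "\<bar>m g\<bar> \<le> K"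
    using K[OF f] K[OF g] f0 g0 by (auto simp: m_def)
  have mfD: "\<bar>m f\<bar> \<le> ?D"
  proof -
    have "\<bar>m f\<bar> \<le> (\<integral>x. ?D \<partial>\<nu>)" unfolding m_def
      by (rule order_trans[OF integral_abs_bound integral_mono]) (use int_f fD in auto)
    then show ?thesis by (simp add: N.prob_space)
  qed
  have "max_dist a (c f, c g) \<le> K"
    using dist_c[of f] dist_c[of g] mf mg by (auto simp: max_dist_def a_eq)
  moreover have "\<bar>obs_cov \<mu> a - obs_cov \<nu> (c f, c g)\<bar> \<le> 3 * ?D * K"
  proof -
    have "obs_cov \<nu> (c f, c g) = (\<integral>x. f x * g x - m g * f x - m f * g x + m f * m g \<partial>\<nu>)"
      by (simp add: obs_cov_def c_apply algebra_simps)
    also have "\<dots> = (\<integral>x. f x * g x \<partial>\<nu>) - m f * m g"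
      using int_f int_g int_fg by (simp add: N.prob_space m_def[symmetric])
    finally have "obs_cov \<mu> a - obs_cov \<nu> (c f, c g)
        = ((\<integral>x. f x * g x \<partial>\<mu>) - (\<integral>x. f x * g x \<partial>\<nu>)) + m f * m g"
      by (simp add: obs_cov_def a_eq)
    moreover have "\<bar>(\<integral>x. f x * g x \<partial>\<mu>) - (\<integral>x. f x * g x \<partial>\<nu>)\<bar> \<le> (?D * 1 + ?D * 1) * K"
      by (intro K lipschitz_on_mult_bounded f g fD gD D)
    moreover have "\<bar>m f * m g\<bar> \<le> ?D * K"
      unfolding abs_mult using mfD mg D by (intro mult_mono) auto
    ultimately show ?thesis by (simp add: algebra_simps)
  qed
  ultimately show ?thesis
    using centered[OF f int_f] centered[OF g int_g] by blast
qed

section \<open>The Hausdorff bound\<close>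

text \<open>
  Admissibility is a strict condition, so the bound \<open>r\<close> itself need not be admissible; all
  larger numbers being so is enough.
\<close>

lemma functional_hausdorff_dist_le:
  assumes "0 \<le> r" and "\<And>\<epsilon>. r < \<epsilon> \<Longrightarrow> hausdorff_admissible d A B \<phi> \<psi> \<epsilon>"
  shows "functional_hausdorff_dist d A B \<phi> \<psi> \<le> r"
proof (rule dense_ge)
  fix \<epsilon> assume "r < \<epsilon>"
  with assms show "functional_hausdorff_dist d A B \<phi> \<psi> \<le> \<epsilon>"
    unfolding functional_hausdorff_dist_def
    by (intro cInf_lower) (auto simp: bdd_below_def intro!: exI[of _ 0])
qed

theorem theorem5p4:
  fixes \<mu> \<nu> :: "'a::metric_space measure"
  assumes "compact (UNIV :: 'a set)"
    and "\<mu> \<in> borel_probs" and "\<nu> \<in> borel_probs"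
  shows "functional_hausdorff_dist max_dist
           (centered_observables \<mu> \<times> centered_observables \<mu>)
           (centered_observables \<nu> \<times> centered_observables \<nu>)
           (obs_cov \<mu>) (obs_cov \<nu>)
         \<le> max 1 (4 * diameter (UNIV :: 'a set)) * wasserstein1 \<mu> \<nu>"
proof -
  let ?D = "diameter (UNIV :: 'a set)"
  let ?C = "max 1 (4 * ?D)"
  let ?H = "functional_hausdorff_dist max_dist
           (centered_observables \<mu> \<times> centered_observables \<mu>)
           (centered_observables \<nu> \<times> centered_observables \<nu>)
           (obs_cov \<mu>) (obs_cov \<nu>)"
  have D: "0 \<le> ?D"
    using dist_le_diameter_compact[OF assms(1), of undefined undefined] by simp
  have bound: "?H \<le> ?C * (\<integral>p. dist (fst p) (snd p) \<partial>h)" if h: "h \<in> couplings \<mu> \<nu>" for h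
  proof -
    define K where "K = (\<integral>p. dist (fst p) (snd p) \<partial>h)"
    have K0: "0 \<le> K" unfolding K_def by (rule Bochner_Integration.integral_nonneg) simp
    have K: "\<bar>(\<integral>x. u x \<partial>\<mu>) - (\<integral>x. u x \<partial>\<nu>)\<bar> \<le> L * K" if "L-lipschitz_on UNIV u" for L u
      using coupling_lipschitz_bound[OF assms(1) h that] by (simp add: K_def)
    then have K': "\<bar>(\<integral>x. u x \<partial>\<nu>) - (\<integral>x. u x \<partial>\<mu>)\<bar> \<le> L * K" if "L-lipschitz_on UNIV u" for L u
      using that by (simp add: abs_minus_commute)
    have le1: "K \<le> ?C * K" using mult_right_mono[of 1 ?C K] K0 by simp
    have le2: "3 * ?D * K \<le> ?C * K" using D K0 by (intro mult_right_mono) auto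
    have "?H \<le> ?C * K"
    proof (rule functional_hausdorff_dist_le)
      show "0 \<le> ?C * K" using le1 K0 by linarith
      fix \<epsilon> assume \<epsilon>: "?C * K < \<epsilon>"
      show "hausdorff_admissible max_dist
           (centered_observables \<mu> \<times> centered_observables \<mu>)
           (centered_observables \<nu> \<times> centered_observables \<nu>)
           (obs_cov \<mu>) (obs_cov \<nu>) \<epsilon>"
        unfolding hausdorff_admissible_def
      proof (intro conjI ballI)
        fix a assume "a \<in> centered_observables \<mu> \<times> centered_observables \<mu>"
        from recenter_pair[OF assms K this]
        show "\<exists>b\<in>centered_observables \<nu> \<times> centered_observables \<nu>.
            max_dist a b < \<epsilon> \<and> \<bar>obs_cov \<mu> a - obs_cov \<nu> b\<bar> < \<epsilon>"
          using le1 le2 \<epsilon> by (meson order_le_less_trans)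
      next
        fix b assume "b \<in> centered_observables \<nu> \<times> centered_observables \<nu>"
        from recenter_pair[OF assms(1,3,2) K' this]
        obtain a where "a \<in> centered_observables \<mu> \<times> centered_observables \<mu>"
          "max_dist b a \<le> K" "\<bar>obs_cov \<nu> b - obs_cov \<mu> a\<bar> \<le> 3 * ?D * K" by blast
        moreover have "max_dist a b = max_dist b a" by (simp add: max_dist_def dist_commute)
        ultimately show "\<exists>a\<in>centered_observables \<mu> \<times> centered_observables \<mu>.
            max_dist a b < \<epsilon> \<and> \<bar>obs_cov \<mu> a - obs_cov \<nu> b\<bar> < \<epsilon>"
          using le1 le2 \<epsilon> by (intro bexI[of _ a]) (auto simp: abs_minus_commute)
      qed
    qed
    then show ?thesis by (simp add: K_def)
  qed
  \<comment> \<open>The constant is positive, so after dividing by it the claim is a lower bound for an infimum.\<close>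
  have "?H / ?C \<le> wasserstein1 \<mu> \<nu>"
    unfolding wasserstein1_def
    by (rule cINF_greatest[OF couplings_nonempty[OF assms]])
      (use bound in \<open>simp add: pos_divide_le_eq mult.commute\<close>)
  then show ?thesis by (simp add: pos_divide_le_eq mult.commute)
qed

end
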